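(* For each integer $n\ge 2$ let $M_n(P)=\{c\in\mathbb{C} : \{P_{n,c}^m(0)\}_{m=1}^{\infty}\text{ is bounded}\}$, where $P_{n,c}(z)=z^n+c$. Let $CS(\hat{\mathbb{C}})$ denote the collection of all compact subsets of the Riemann sphere $\hat{\mathbb{C}}$. Then $$\lim_{n\to\infty} M_n(P)=\overline{\mathbb{D}}$$ under the Hausdorff metric $d_{\mathcal{H}}$ in $CS(\hat{\mathbb{C}})$.
   Context: $\mathbb{D}$ is the open unit disk in $\mathbb{C}$ and $\overline{\mathbb{D}}$ its closure. $P_{n,c}^m$ denotes the $m$-th iterate of $P_{n,c}$. The Hausdorff metric is $d_{\mathcal{H}}(A,B)=\max\{\sup_{a\in A}\inf_{b\in B}d(a,b),\ \sup_{b\in B}\inf_{a\in A}d(a,b)\}$. For compact sets $S_n,S$, $\lim_{n\to\infty}S_n=S$ means that for all $\epsilon>0$ there is an $N$ such that $d_{\mathcal{H}}(S_n,S)<\epsilon$ for all $n\ge N$. (For uniformly bounded subsets of $\mathbb{C}$ one may equivalently use the Euclidean distance.) *)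

theory Defs
  imports "HOL-Analysis.Analysis"
begin

definition P :: "nat \<Rightarrow> complex \<Rightarrow> complex \<Rightarrow> complex" where
  "P n c z = z ^ n + c"

definition M :: "nat \<Rightarrow> complex set" where
  "M n = {c. bounded {(P n c ^^ m) 0 | m. m \<ge> 1}}"

text \<open>
  The Riemann sphere is the unit sphere of \<open>\<complex> \<times> \<real>\<close> with the metric inherited
  from the ambient Euclidean space; the complex plane is embedded by inverse stereographic
  projection from the pole \<open>(0, 1)\<close>, which is the point at infinity. The lemmas below
  check this, in particular that the induced metric on the plane is the chordal metric.
\<close>

definition riemann_sphere :: "(complex \<times> real) set" where
  "riemann_sphere = sphere 0 1"

definition to_sphere :: "complex \<Rightarrow> complex \<times> real" where
  "to_sphere z = ((2 / (1 + (norm z)\<^sup>2)) *\<^sub>R z, ((norm z)\<^sup>2 - 1) / ((norm z)\<^sup>2 + 1))"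

definition CS :: "(complex \<times> real) set set" where
  "CS = {K. K \<subseteq> riemann_sphere \<and> compact K}"

text \<open>
  This is the Hausdorff distance only for nonempty bounded sets; for other arguments the real
  suprema and infima have unspecified values.
\<close>

definition hausdorff_dist :: "'a::metric_space set \<Rightarrow> 'a set \<Rightarrow> real" where
  "hausdorff_dist A B = max (SUP a\<in>A. INF b\<in>B. dist a b) (SUP b\<in>B. INF a\<in>A. dist a b)"

definition hausdorff_lim :: "(nat \<Rightarrow> 'a::metric_space set) \<Rightarrow> 'a set \<Rightarrow> bool" where
  "hausdorff_lim S L \<longleftrightarrow> (\<forall>\<epsilon>>0. \<exists>N. \<forall>n\<ge>N. hausdorff_dist (S n) L < \<epsilon>)"

lemma dist_to_sphere:
  "dist (to_sphere z) (to_sphere w) =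
     2 * dist z w / (sqrt (1 + (norm z)\<^sup>2) * sqrt (1 + (norm w)\<^sup>2))"
proof -
  obtain a b where z: "z = Complex a b" by (cases z)
  obtain c d where w: "w = Complex c d" by (cases w)
  define s where "s = 1 + (a\<^sup>2 + b\<^sup>2)"
  define t where "t = 1 + (c\<^sup>2 + d\<^sup>2)"
  have pos: "s > 0" "t > 0"
    unfolding s_def t_def by (simp_all add: add_pos_nonneg)
  have s': "(norm z)\<^sup>2 = s - 1" "(norm w)\<^sup>2 = t - 1"
    by (simp_all add: z w s_def t_def cmod_power2)
  have "(dist (to_sphere z) (to_sphere w))\<^sup>2 =
      (2/s*a - 2/t*c)\<^sup>2 + (2/s*b - 2/t*d)\<^sup>2 + ((s-2)/s - (t-2)/t)\<^sup>2"
    unfolding to_sphere_def dist_Pair_Pair s'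
    by (simp add: dist_norm cmod_power2 z w)
  also have "\<dots> = 4 * ((a-c)\<^sup>2 + (b-d)\<^sup>2) / (s*t)"
  proof -
    have "(2/s*a - 2/t*c)\<^sup>2 + (2/s*b - 2/t*d)\<^sup>2 + ((s-2)/s - (t-2)/t)\<^sup>2
       = (4 * ((t*a - s*c)\<^sup>2 + (t*b - s*d)\<^sup>2 + (s-t)\<^sup>2)) / (s*t)\<^sup>2"
      using pos by (simp add: divide_simps power2_eq_square) algebra
    also have "(t*a - s*c)\<^sup>2 + (t*b - s*d)\<^sup>2 + (s-t)\<^sup>2 = (s*t) * ((a-c)\<^sup>2 + (b-d)\<^sup>2)"
      unfolding s_def t_def by algebra
    finally show ?thesis
      using pos by (simp add: divide_simps power2_eq_square)
  qed
  also have "\<dots> = (2 * dist z w / (sqrt (1 + (norm z)\<^sup>2) * sqrt (1 + (norm w)\<^sup>2)))\<^sup>2"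
    unfolding s' using pos
    by (simp add: power_divide power_mult_distrib dist_norm cmod_power2 z w)
  finally show ?thesis
    by (rule power2_eq_imp_eq) auto
qed

lemma inj_to_sphere: "inj to_sphere"
proof (rule injI)
  fix z w assume "to_sphere z = to_sphere w"
  hence "dist (to_sphere z) (to_sphere w) = 0" by simp
  moreover have "1 + (norm x)\<^sup>2 \<noteq> 0" for x :: complex
    using zero_le_power2[of "norm x"] by linarith
  ultimately show "z = w" by (simp add: dist_to_sphere)
qed

lemma range_to_sphere: "range to_sphere = riemann_sphere - {(0, 1)}"
proof (intro equalityI subsetI)
  fix p assume "p \<in> range to_sphere"
  then obtain z where p: "p = to_sphere z" by blast
  define r where "r = (norm z)\<^sup>2"
  have r: "r \<ge> 0" by (simp add: r_def)
  have "(norm p)\<^sup>2 = (2/(1+r))\<^sup>2 * r + ((r-1)/(r+1))\<^sup>2"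
    by (simp add: p to_sphere_def norm_Pair r_def power_mult_distrib power_divide)
  also have "\<dots> = 1"
    using r by (simp add: divide_simps add_nonneg_eq_0_iff power2_eq_square) algebra
  finally have "norm p = 1" by (simp add: power2_eq_1_iff) (use norm_ge_zero[of p] in linarith)
  moreover have "snd p \<noteq> 1" using r by (simp add: p to_sphere_def r_def[symmetric] divide_simps)
  ultimately show "p \<in> riemann_sphere - {(0, 1)}" by (auto simp: riemann_sphere_def)
next
  fix p assume p: "p \<in> riemann_sphere - {(0, 1)}"
  obtain u h where uh: "p = (u, h)" by (cases p)
  have "sqrt ((norm u)\<^sup>2 + h\<^sup>2) = 1" using p by (simp add: riemann_sphere_def uh norm_Pair)
  hence n: "(norm u)\<^sup>2 = 1 - h\<^sup>2" by simp
  have h: "h \<noteq> 1" using p n by (auto simp: uh)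
  define z where "z = (1 / (1 - h)) *\<^sub>R u"
  have "(norm z)\<^sup>2 = (1 - h\<^sup>2) / (1 - h)\<^sup>2"
    by (simp add: z_def power_divide n)
  also have "\<dots> = (1 + h) / (1 - h)"
    using h by (simp add: divide_simps power2_eq_square) algebra
  finally have z: "(norm z)\<^sup>2 = (1 + h) / (1 - h)" .
  have eqs: "1 + (1 + h) / (1 - h) = 2 / (1 - h)" "(1 + h) / (1 - h) - 1 = 2 * h / (1 - h)"
    using h by (simp_all add: divide_simps)
  have "to_sphere z = (u, h)"
    unfolding to_sphere_def z add.commute[of _ "1::real"] eqs using h by (simp add: z_def)
  thus "p \<in> range to_sphere" unfolding uh by (metis rangeI)
qed

end

theory Submission
  imports Defs
begin

text \<open>
  For large \<open>n\<close> the map \<open>z \<mapsto> z ^ n\<close> crushes every disk of radius below 1 to almost a point and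
  expands enormously outside every disk of radius above 1, so the behaviour of the orbit of 0 under
  \<open>z \<mapsto> z ^ n + c\<close> is decided by whether \<open>norm c\<close> is smaller or larger than 1, with an error that
  tends to 0.

  Inside: if \<open>norm c \<le> s - s ^ n\<close>, the disk of radius \<open>s\<close> is mapped into itself, hence \<open>c\<close> lies in
  \<open>M n\<close> (\<open>M_contains_cball\<close>). With \<open>s\<close> slightly below 1 the term \<open>s ^ n\<close> tends to 0.
  Outside: once an iterate \<open>z\<close> satisfies \<open>norm z \<ge> norm c\<close> and \<open>norm z ^ (n - 1) > 2\<close>, the moduli
  grow at least geometrically from there on (\<open>escape_growth\<close>). Applied to the first iterate, which
  is \<open>c\<close> itself, this gives \<open>norm c ^ (n - 1) \<le> 2\<close> on \<open>M n\<close>, and the \<open>(n - 1)\<close>-st root of 2 tends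
  to 1.

  So \<open>M n\<close> is eventually squeezed between the disks of radii \<open>1 - \<delta>\<close> and \<open>1 + \<delta>\<close>
  (\<open>M_eventually_squeezed\<close>), which bounds the Euclidean Hausdorff distance to the closed unit disk
  by \<open>\<delta>\<close>; stereographic projection is 2-Lipschitz and at most doubles this. Compactness of \<open>M n\<close>
  also comes from the escape criterion: it turns boundedness of the orbit into the uniform bound 2
  on all iterates, a closed condition on \<open>c\<close>.
\<close>

section \<open>Escaping and trapped critical orbits\<close>

text \<open>
  The map multiplies the modulus by at least \<open>norm z ^ (n - 1) - 1 > 1\<close>, because
  \<open>norm (z ^ n + c) \<ge> norm z * norm z ^ (n - 1) - norm z\<close> when \<open>norm c \<le> norm z\<close>. The hypotheses
  persist along the orbit since the moduli do not decrease.
\<close>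

lemma escape_growth:
  assumes "norm c \<le> norm z" and "norm z ^ (n - 1) > 2"
  shows "norm z * (norm z ^ (n - 1) - 1) ^ k \<le> norm ((P n c ^^ k) z)"
proof (induction k)
  case 0
  show ?case by simp
next
  case (Suc k)
  define q where "q = norm z ^ (n - 1) - 1"
  define w where "w = (P n c ^^ k) z"
  have q: "q > 1" using assms by (simp add: q_def)
  have n: "n = Suc (n - 1)" using assms by (cases n) auto
  have IH: "norm z * q ^ k \<le> norm w" using Suc by (simp add: q_def w_def)
  have "norm z * 1 \<le> norm z * q ^ k"
    using q by (intro mult_left_mono) (auto simp: one_le_power)
  hence zw: "norm z \<le> norm w" using IH by simp
  have "norm z * q ^ Suc k = (norm z * q ^ k) * q" by simp
  also have "\<dots> \<le> norm w * q" using IH q by (intro mult_right_mono) auto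
  also have "\<dots> \<le> norm w * (norm w ^ (n - 1) - 1)"
    using zw by (intro mult_left_mono) (auto simp: q_def intro: power_mono)
  also have "\<dots> = norm w ^ n - norm w"
    by (subst (2) n) (simp add: algebra_simps)
  also have "\<dots> \<le> norm (w ^ n) - norm c"
    using zw assms by (simp add: norm_power)
  also have "\<dots> \<le> norm (w ^ n + c)" by (rule norm_diff_ineq)
  also have "\<dots> = norm ((P n c ^^ Suc k) z)" by (simp add: P_def[of n c w] flip: w_def)
  finally show ?case by (simp only: q_def)
qed

lemma escape_not_in_M:
  assumes "j \<ge> 1" and "norm c \<le> norm ((P n c ^^ j) 0)" and "norm ((P n c ^^ j) 0) ^ (n - 1) > 2"
  shows "c \<notin> M n"
proof
  define z where "z = (P n c ^^ j) 0"
  define q where "q = norm z ^ (n - 1) - 1"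
  assume "c \<in> M n"
  then obtain B where B: "norm ((P n c ^^ m) 0) \<le> B" if "m \<ge> 1" for m
    unfolding M_def bounded_iff by blast
  have q: "q > 1" using assms by (simp add: q_def z_def)
  (* Geometric growth from 0 would be no growth; z = 0 is excluded since 0 ^ (n - 1) \<le> 1. *)
  have z: "norm z > 0"
  proof (rule ccontr)
    assume "\<not> norm z > 0"
    hence "norm z ^ (n - 1) \<le> 1" by (auto simp: power_0_left)
    thus False using q by (simp add: q_def)
  qed
  obtain k where "B / norm z < q ^ k" using real_arch_pow[OF q] by blast
  hence "B < norm z * q ^ k" using z by (simp add: field_simps)
  also have "\<dots> \<le> norm ((P n c ^^ k) z)"
    using escape_growth[of c z n k] assms by (simp add: q_def z_def)
  also have "\<dots> = norm ((P n c ^^ (k + j)) 0)" by (simp add: z_def funpow_add)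
  also have "\<dots> \<le> B" using assms(1) by (intro B) auto
  finally show False by simp
qed

lemma norm_power_le_2_on_M:
  assumes "n \<ge> 2" and "c \<in> M n"
  shows "norm c ^ (n - 1) \<le> 2"
proof -
  have "(P n c ^^ 1) 0 = c" using assms by (simp add: P_def)
  thus ?thesis using escape_not_in_M[of 1 c n] assms by force
qed

text \<open>
  A self-mapped disk traps the orbit of its centre.
\<close>

lemma M_contains_cball:
  assumes "0 \<le> s"
  shows "cball 0 (s - s ^ n) \<subseteq> M n"
proof
  fix c :: complex assume c: "c \<in> cball 0 (s - s ^ n)"
  have "norm ((P n c ^^ m) 0) \<le> s" for m
  proof (induction m)
    case (Suc m)
    have "norm (P n c ((P n c ^^ m) 0)) \<le> norm ((P n c ^^ m) 0) ^ n + norm c"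
      unfolding P_def by (metis norm_power norm_triangle_ineq)
    also have "\<dots> \<le> s ^ n + (s - s ^ n)"
      using c Suc by (intro add_mono power_mono) auto
    finally show ?case by simp
  qed (use assms in simp)
  thus "c \<in> M n" unfolding M_def bounded_iff by blast
qed

section \<open>Compactness\<close>

text \<open>
  The radius 2 serves all \<open>n \<ge> 2\<close> at once, since \<open>norm z > 2\<close> implies \<open>norm z ^ (n - 1) > 2\<close>.
\<close>

lemma M_eq_iterates_le_2:
  assumes "n \<ge> 2"
  shows "M n = {c. \<forall>m\<ge>1. norm ((P n c ^^ m) 0) \<le> 2}"
proof (intro equalityI subsetI)
  fix c assume c: "c \<in> M n"
  have pow: "x ^ (n - 1) > 2" if "x > 2" for x :: real
    using that assms self_le_power[of x "n - 1"] by simp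
  have c2: "norm c \<le> 2"
    using norm_power_le_2_on_M[OF assms c] pow[of "norm c"] by force
  have "norm ((P n c ^^ m) 0) \<le> 2" if "m \<ge> 1" for m
    using escape_not_in_M[OF that, of c n] c c2 pow[of "norm ((P n c ^^ m) 0)"] by force
  thus "c \<in> {c. \<forall>m\<ge>1. norm ((P n c ^^ m) 0) \<le> 2}" by simp
next
  fix c assume "c \<in> {c. \<forall>m\<ge>1. norm ((P n c ^^ m) 0) \<le> 2}"
  thus "c \<in> M n" unfolding M_def bounded_iff by auto
qed

lemma compact_M:
  assumes "n \<ge> 2"
  shows "compact (M n)"
proof -
  have cont: "continuous_on UNIV (\<lambda>c. (P n c ^^ m) 0)" for m
    by (induction m) (auto simp: P_def intro!: continuous_intros)
  have "M n = (\<Inter>m\<in>{1..}. {c. norm ((P n c ^^ m) 0) \<le> 2})"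
    using M_eq_iterates_le_2[OF assms] by auto
  moreover have "closed \<dots>"
    by (intro closed_INT ballI closed_Collect_le continuous_on_norm cont continuous_on_const)
  ultimately have "closed (M n)" by simp
  moreover have "norm c \<le> 2" if "c \<in> M n" for c
  proof -
    have "norm ((P n c ^^ 1) 0) \<le> 2" using that M_eq_iterates_le_2[OF assms] by blast
    thus ?thesis using assms by (simp add: P_def power_0_left)
  qed
  hence "bounded (M n)" unfolding bounded_iff by blast
  ultimately show ?thesis by (simp add: compact_eq_bounded_closed)
qed

section \<open>Stereographic projection\<close>

lemma dist_to_sphere_le: "dist (to_sphere z) (to_sphere w) \<le> 2 * dist z w"
proof -
  have "1 \<le> sqrt (1 + (norm x)\<^sup>2)" for x :: complex by simp
  hence "1 * 1 \<le> sqrt (1 + (norm z)\<^sup>2) * sqrt (1 + (norm w)\<^sup>2)"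
    by (intro mult_mono) auto
  hence "2 * dist z w / (sqrt (1 + (norm z)\<^sup>2) * sqrt (1 + (norm w)\<^sup>2)) \<le> 2 * dist z w / 1"
    by (intro divide_left_mono) auto
  thus ?thesis by (simp add: dist_to_sphere)
qed

lemma to_sphere_image_in_CS:
  assumes "compact K"
  shows "to_sphere ` K \<in> CS"
proof -
  have "2-lipschitz_on K to_sphere"
    by (rule lipschitz_onI) (simp_all add: dist_to_sphere_le)
  hence "compact (to_sphere ` K)"
    using assms by (intro compact_continuous_image lipschitz_on_continuous_on)
  thus ?thesis using range_to_sphere by (auto simp: CS_def)
qed

section \<open>Hausdorff convergence\<close>

lemma hausdorff_dist_le:
  assumes "A \<noteq> {}" and "B \<noteq> {}"
    and "\<And>a. a \<in> A \<Longrightarrow> \<exists>b\<in>B. dist a b \<le> r"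
    and "\<And>b. b \<in> B \<Longrightarrow> \<exists>a\<in>A. dist a b \<le> r"
  shows "hausdorff_dist A B \<le> r"
proof -
  have bdd: "bdd_below ((\<lambda>x. dist (f x) (g x)) ` X)" for f g :: "_ \<Rightarrow> 'a" and X :: "'a set"
    by (rule bdd_belowI[of _ 0]) auto
  have "(INF b\<in>B. dist a b) \<le> r" if "a \<in> A" for a
    using assms(3)[OF that] by (auto intro: cINF_lower2[OF bdd])
  moreover have "(INF a\<in>A. dist a b) \<le> r" if "b \<in> B" for b
    using assms(4)[OF that] by (auto intro: cINF_lower2[OF bdd])
  ultimately show ?thesis
    unfolding hausdorff_dist_def using assms(1,2) by (intro max.boundedI cSUP_least)
qed

text \<open>
  Here \<open>s = 1 - \<delta> / 2\<close> splits the allowed gap \<open>\<delta>\<close> evenly: one half is the distance of \<open>s\<close> from 1,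
  the other absorbs \<open>s ^ n\<close>.
\<close>

lemma M_eventually_squeezed:
  assumes "0 < \<delta>" and "\<delta> < 1"
  shows "\<exists>N. \<forall>n\<ge>N. cball 0 (1 - \<delta>) \<subseteq> M n \<and> M n \<subseteq> cball 0 (1 + \<delta>)"
proof -
  define s where "s = 1 - \<delta> / 2"
  have s: "0 \<le> s" "s \<le> 1" using assms by (auto simp: s_def)
  obtain k where k: "s ^ k < \<delta> / 2"
    using real_arch_pow_inv[of "\<delta> / 2" s] assms by (auto simp: s_def)
  obtain l where l: "2 < (1 + \<delta>) ^ l"
    using real_arch_pow[of "1 + \<delta>" 2] assms by auto
  have "cball 0 (1 - \<delta>) \<subseteq> M n \<and> M n \<subseteq> cball 0 (1 + \<delta>)" if n: "n \<ge> k + l + 2" for n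
  proof
    have "s ^ n \<le> s ^ k" using n s by (intro power_decreasing) auto
    hence "1 - \<delta> \<le> s - s ^ n" using k by (simp add: s_def)
    hence "cball 0 (1 - \<delta>) \<subseteq> cball (0 :: complex) (s - s ^ n)" by (rule subset_cball)
    thus "cball 0 (1 - \<delta>) \<subseteq> M n" using M_contains_cball[OF s(1), of n] by blast
    show "M n \<subseteq> cball 0 (1 + \<delta>)"
    proof
      fix c assume c: "c \<in> M n"
      have "norm c \<le> 1 + \<delta>"
      proof (rule ccontr)
        assume "\<not> norm c \<le> 1 + \<delta>"
        hence "(1 + \<delta>) ^ (n - 1) \<le> norm c ^ (n - 1)"
          using assms by (intro power_mono) auto
        moreover have "(1 + \<delta>) ^ l \<le> (1 + \<delta>) ^ (n - 1)"
          using n assms by (intro power_increasing) auto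
        moreover have "norm c ^ (n - 1) \<le> 2"
          using n by (intro norm_power_le_2_on_M[OF _ c]) simp
        ultimately show False using l by linarith
      qed
      thus "c \<in> cball 0 (1 + \<delta>)" by simp
    qed
  qed
  thus ?thesis by blast
qed

text \<open>
  Points of the larger disk are moved by at most \<open>\<delta>\<close> into the smaller one by a radial scaling.
\<close>

lemma cball_shrink:
  fixes z :: "'a::real_normed_vector"
  assumes "z \<in> cball 0 (r + \<delta>)" and "0 \<le> r" and "0 \<le> \<delta>"
  shows "\<exists>w\<in>cball 0 r. dist z w \<le> \<delta>"
proof (cases "r + \<delta> = 0")
  case True
  thus ?thesis using assms by (intro bexI[of _ z]) auto
next
  case False
  hence pos: "r + \<delta> > 0" using assms by auto
  define w where "w = (r / (r + \<delta>)) *\<^sub>R z"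
  have z: "norm z / (r + \<delta>) \<le> 1" using assms pos by simp
  have "norm w = r * (norm z / (r + \<delta>))" using assms by (simp add: w_def)
  also have "\<dots> \<le> r" using z assms by (intro mult_left_le)
  finally have "w \<in> cball 0 r" by simp
  moreover have "z - w = (\<delta> / (r + \<delta>)) *\<^sub>R z"
  proof -
    have "z - w = (1 - r / (r + \<delta>)) *\<^sub>R z" by (simp add: w_def scaleR_left_diff_distrib)
    also have "1 - r / (r + \<delta>) = \<delta> / (r + \<delta>)" using pos by (simp add: field_simps)
    finally show ?thesis .
  qed
  hence "dist z w = \<delta> * (norm z / (r + \<delta>))" using assms by (simp add: dist_norm)
  hence "dist z w \<le> \<delta>" using z assms mult_left_le[of "norm z / (r + \<delta>)" \<delta>] by simp
  ultimately show ?thesis by blast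
qed

text \<open>
  A point of \<open>K\<close> is shrunk into the unit disk, a point of the unit disk into the disk of radius
  \<open>1 - \<delta>\<close> and hence into \<open>K\<close>; the factor 2 is the Lipschitz constant of the projection.
\<close>

lemma hausdorff_dist_sphere_squeezed:
  assumes "0 < \<delta>" and "\<delta> < 1"
    and "cball 0 (1 - \<delta>) \<subseteq> K" and "K \<subseteq> cball 0 (1 + \<delta>)"
  shows "hausdorff_dist (to_sphere ` K) (to_sphere ` cball 0 1) \<le> 2 * \<delta>"
proof (rule hausdorff_dist_le)
  show "to_sphere ` K \<noteq> {}" using assms by auto
  show "to_sphere ` cball 0 1 \<noteq> {}" by simp
next
  fix p assume "p \<in> to_sphere ` K"
  then obtain z where z: "z \<in> K" "p = to_sphere z" by blast
  then obtain w where "w \<in> cball 0 1" "dist z w \<le> \<delta>"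
    using cball_shrink[of z 1 \<delta>] assms by force
  thus "\<exists>q\<in>to_sphere ` cball 0 1. dist p q \<le> 2 * \<delta>"
    using z dist_to_sphere_le[of z w] by (intro bexI[of _ "to_sphere w"]) auto
next
  fix q assume "q \<in> to_sphere ` cball 0 1"
  then obtain z where z: "z \<in> cball 0 1" "q = to_sphere z" by blast
  then obtain w where "w \<in> cball 0 (1 - \<delta>)" "dist z w \<le> \<delta>"
    using cball_shrink[of z "1 - \<delta>" \<delta>] assms by force
  thus "\<exists>p\<in>to_sphere ` K. dist p q \<le> 2 * \<delta>"
    using z assms dist_to_sphere_le[of w z]
    by (intro bexI[of _ "to_sphere w"]) (auto simp: dist_commute)
qed

theorem theorem1p1:
  shows "(\<forall>n\<ge>2. to_sphere ` M n \<in> CS) \<and>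
         to_sphere ` closure (ball 0 1) \<in> CS \<and>
         hausdorff_lim (\<lambda>n. to_sphere ` M n) (to_sphere ` closure (ball 0 1))"
proof (intro conjI allI impI)
  have cl: "closure (ball 0 1) = cball (0 :: complex) 1" by simp
  show "to_sphere ` M n \<in> CS" if "n \<ge> 2" for n
    by (intro to_sphere_image_in_CS compact_M that)
  show "to_sphere ` closure (ball 0 1) \<in> CS"
    unfolding cl by (intro to_sphere_image_in_CS compact_cball)
  show "hausdorff_lim (\<lambda>n. to_sphere ` M n) (to_sphere ` closure (ball 0 1))"
    unfolding hausdorff_lim_def cl
  proof (intro allI impI)
    fix \<epsilon> :: real assume "\<epsilon> > 0"
    define \<delta> where "\<delta> = min (1 / 2) (\<epsilon> / 4)"
    have \<delta>: "0 < \<delta>" "\<delta> < 1" "2 * \<delta> < \<epsilon>" using \<open>\<epsilon> > 0\<close> by (auto simp: \<delta>_def min_def)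
    obtain N where "\<forall>n\<ge>N. cball 0 (1 - \<delta>) \<subseteq> M n \<and> M n \<subseteq> cball 0 (1 + \<delta>)"
      using M_eventually_squeezed[OF \<delta>(1,2)] by blast
    hence "hausdorff_dist (to_sphere ` M n) (to_sphere ` cball 0 1) < \<epsilon>" if "n \<ge> N" for n
      using hausdorff_dist_sphere_squeezed[OF \<delta>(1,2), of "M n"] \<delta>(3) that by fastforce
    thus "\<exists>N. \<forall>n\<ge>N. hausdorff_dist (to_sphere ` M n) (to_sphere ` cball 0 1) < \<epsilon>" by blast
  qed
qed

end
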